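(* For any $n\ge 3$, let $\mathrm{tw}(C_n)$ be the graph obtained from the cycle $C_n$ by adding a new vertex $v'$ adjacent to a vertex $v$ of $C_n$ and to both neighbors of $v$ in $C_n$. Then \[ X_{\mathrm{tw}(C_n)}=\sum_{I\vDash n,\ i_1\ge 4}2(i_1-3)w_{1I}e_{1I}+\sum_{I\in\mathcal W_{n+1},\ i_1,i_{-1}\ge 3}2(2i_1-5)w_Ie_I+\sum_{I\in\mathcal W_{n-1},\ i_1\ge 3}4\Bigl(i_1-3+\frac{1}{i_1}\Bigr)w_Ie_{I2}. \]
   Context: $X_G=\sum_\kappa\prod_{v\in V(G)}x_{\kappa(v)}$ summed over proper colorings $\kappa:V(G)\to\{1,2,\dots\}$. A composition $I=i_1\cdots i_l\vDash n$ is a sequence of positive integers with sum $n$; $i_{-1}=i_l$; $1I$ denotes the composition $1i_1\cdots i_l$ and $I2$ the composition $i_1\cdots i_l2$. $e_I=e_{i_1}\cdots e_{i_l}$ with $e_k$ elementary symmetric functions. $w_I=i_1(i_2-1)\cdots(i_l-1)$. $\mathcal W_n$ is the set of compositions of $n$ all of whose parts are at least $2$. *)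

theory Defs
  imports Complex_Main "HOL-Library.Multiset" "HOL-Library.FuncSet"
begin

section \<open>Formal power series in the variables $x_0, x_1, x_2, \dots$\<close>

text \<open>A monomial is a finite multiset of variable indices; a series assigns a coefficient to each
  monomial. The monomials of a series may involve infinitely many variables altogether.
  The variable with index 0 exists but is not used by the symmetric functions below.\<close>

typedef 'a mfps = "UNIV :: (nat multiset \<Rightarrow> 'a) set"
  morphisms mfps_coeff Abs_mfps by simp

setup_lifting type_definition_mfps

lemma mfps_eqI: "(\<And>m. mfps_coeff f m = mfps_coeff g m) \<Longrightarrow> f = g"
  by transfer auto

lemma finite_submultisets: "finite {a. a \<subseteq># (m :: 'b multiset)}"
proof (induction m)
  case (add x m)
  have "{a. a \<subseteq># add_mset x m} \<subseteq> {a. a \<subseteq># m} \<union> add_mset x ` {a. a \<subseteq># m}"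
  proof
    fix a assume a: "a \<in> {a. a \<subseteq># add_mset x m}"
    show "a \<in> {a. a \<subseteq># m} \<union> add_mset x ` {a. a \<subseteq># m}"
    proof (cases "x \<in># a")
      case True
      then obtain b where "a = add_mset x b" by (meson multi_member_split)
      with a show ?thesis by auto
    next
      case False
      have "count a y \<le> count m y" for y
        using a False
        by (cases "y = x")
          (auto simp: subseteq_mset_def not_in_iff split: if_splits dest!: spec[of _ y])
      then show ?thesis by (simp add: subseteq_mset_def)
    qed
  qed
  with add show ?case by (meson finite_UnI finite_imageI finite_subset)
qed simp

lemma finite_antidiagonal: "finite {(a, b). a + b = (m :: 'b multiset)}"
  by (rule finite_subset[of _ "{a. a \<subseteq># m} \<times> {a. a \<subseteq># m}"]) (auto simp: finite_submultisets)

instantiation mfps :: (comm_ring_1) comm_ring_1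
begin

lift_definition zero_mfps :: "'a mfps" is "\<lambda>_. 0" .
lift_definition one_mfps :: "'a mfps" is "\<lambda>m. if m = {#} then 1 else 0" .
lift_definition plus_mfps :: "'a mfps \<Rightarrow> 'a mfps \<Rightarrow> 'a mfps" is "\<lambda>f g m. f m + g m" .
lift_definition uminus_mfps :: "'a mfps \<Rightarrow> 'a mfps" is "\<lambda>f m. - f m" .
lift_definition minus_mfps :: "'a mfps \<Rightarrow> 'a mfps \<Rightarrow> 'a mfps" is "\<lambda>f g m. f m - g m" .
lift_definition times_mfps :: "'a mfps \<Rightarrow> 'a mfps \<Rightarrow> 'a mfps" is
  "\<lambda>f g m. \<Sum>(a, b) | a + b = m. f a * g b" .

instance
proof
  fix f g h :: "'a mfps"
  show "f * g = g * f"
  proof (transfer, rule ext)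
    fix f g :: "nat multiset \<Rightarrow> 'a" and m
    show "(\<Sum>(a, b) | a + b = m. f a * g b) = (\<Sum>(a, b) | a + b = m. g a * f b)"
      by (rule sum.reindex_bij_witness[of _ prod.swap prod.swap])
         (auto simp: add.commute mult.commute)
  qed
  show "f * g * h = f * (g * h)"
  proof (transfer, rule ext)
    fix f g h :: "nat multiset \<Rightarrow> 'a" and m
    have "(\<Sum>(c, d) | c + d = m. (\<Sum>(a, b) | a + b = c. f a * g b) * h d)
        = (\<Sum>p\<in>{(c, d). c + d = m}. \<Sum>q\<in>{(a, b). a + b = fst p}. f (fst q) * g (snd q) * h (snd p))"
      by (simp add: case_prod_unfold sum_distrib_right)
    also have "\<dots> = (\<Sum>(p, q)\<in>Sigma {(c, d). c + d = m} (\<lambda>p. {(a, b). a + b = fst p}).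
        f (fst q) * g (snd q) * h (snd p))"
      by (rule sum.Sigma) (auto simp: finite_antidiagonal)
    also have "\<dots> = (\<Sum>(p, q)\<in>Sigma {(c, d). c + d = m} (\<lambda>p. {(a, b). a + b = snd p}).
        f (fst p) * (g (fst q) * h (snd q)))"
      by (rule sum.reindex_bij_witness[of _
            "\<lambda>((a, bd), (b, d)). ((a + b, d), (a, b))"
            "\<lambda>((c, d), (a, b)). ((a, b + d), (b, d))"])
         (auto simp: ac_simps)
    also have "\<dots> = (\<Sum>p\<in>{(c, d). c + d = m}. \<Sum>q\<in>{(a, b). a + b = snd p}.
        f (fst p) * (g (fst q) * h (snd q)))"
      by (rule sum.Sigma[symmetric]) (auto simp: finite_antidiagonal)
    also have "\<dots> = (\<Sum>(a, c) | a + c = m. f a * (\<Sum>(b, d) | b + d = c. g b * h d))"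
      by (simp add: case_prod_unfold sum_distrib_left)
    finally show "(\<Sum>(c, d) | c + d = m. (\<Sum>(a, b) | a + b = c. f a * g b) * h d)
        = (\<Sum>(a, c) | a + c = m. f a * (\<Sum>(b, d) | b + d = c. g b * h d))" .
  qed
  show "1 * f = f"
  proof (transfer, rule ext)
    fix f :: "nat multiset \<Rightarrow> 'a" and m
    have "(\<Sum>(a, b) | a + b = m. (if a = {#} then 1 else 0) * f b)
        = (\<Sum>(a, b)\<in>{({#} :: nat multiset, m)}. (if a = {#} then 1 else 0) * f b)"
      by (rule sum.mono_neutral_right) (auto simp: finite_antidiagonal split: if_splits)
    then show "(\<Sum>(a, b) | a + b = m. (if a = {#} then 1 else 0) * f b) = f m" by simp
  qed
  show "(f + g) * h = f * h + g * h"
    by transfer (auto simp: case_prod_unfold distrib_right sum.distrib)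
  show "(0 :: 'a mfps) \<noteq> 1"
    by transfer (metis zero_neq_one)
qed (transfer; auto simp: algebra_simps)+

end

lift_definition mfps_scale :: "'a::comm_ring_1 \<Rightarrow> 'a mfps \<Rightarrow> 'a mfps" is "\<lambda>c f m. c * f m" .

lift_definition mfps_var :: "nat \<Rightarrow> 'a::comm_ring_1 mfps" is
  "\<lambda>i m. if m = {#i#} then 1 else 0" .

text \<open>The sum of a possibly infinite family of series, taken coefficient by coefficient.
  It is meaningful when every monomial has a nonzero coefficient in only finitely many members of
  the family; this holds for the two families used below, see
  \<open>finite_colorings_monomial\<close> and \<open>finite_elem_monomial\<close>.\<close>

lift_definition mfps_Sum :: "('b \<Rightarrow> 'a::comm_ring_1 mfps) \<Rightarrow> 'b set \<Rightarrow> 'a mfps" is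
  "\<lambda>f A m. \<Sum>k | k \<in> A \<and> f k m \<noteq> 0. f k m" .

lemma mfps_coeff_prod_var:
  assumes "finite V"
  shows "mfps_coeff (\<Prod>v\<in>V. mfps_var (k v) :: 'a::comm_ring_1 mfps) m
           = (if m = image_mset k (mset_set V) then 1 else 0)"
  using assms
proof (induction V arbitrary: m)
  case empty
  show ?case by (simp add: one_mfps.rep_eq)
next
  case (insert v V)
  let ?M = "image_mset k (mset_set V)"
  have "mfps_coeff (\<Prod>v\<in>insert v V. mfps_var (k v) :: 'a mfps) m
      = (\<Sum>(a, b) | a + b = m. (if a = {#k v#} then 1 else 0) * (if b = ?M then 1 else 0))"
    using insert by (simp add: times_mfps.rep_eq mfps_var.rep_eq)
  also have "\<dots> = (\<Sum>p | fst p + snd p = m. if p = ({#k v#}, ?M) then 1 else 0)"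
    by (rule sum.cong) (simp_all add: case_prod_unfold prod_eq_iff)
  also have "\<dots> = (if m = add_mset (k v) ?M then 1 else 0)"
    using finite_antidiagonal[of m] by (auto simp: sum.delta case_prod_unfold)
  finally show ?case using insert by simp
qed


section \<open>Chromatic symmetric functions\<close>

text \<open>A graph is a vertex set together with a set of edges, each a two-element set of vertices.\<close>

type_synonym 'v graph = "'v set \<times> 'v set set"

definition proper_colorings :: "'v graph \<Rightarrow> ('v \<Rightarrow> nat) set" where
  "proper_colorings G =
     {k \<in> fst G \<rightarrow>\<^sub>E {1..}. \<forall>u v. {u, v} \<in> snd G \<longrightarrow> k u \<noteq> k v}"

definition chromatic_sym :: "'v graph \<Rightarrow> rat mfps" where
  "chromatic_sym G = mfps_Sum (\<lambda>k. \<Prod>v\<in>fst G. mfps_var (k v)) (proper_colorings G)"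

definition elem_sym :: "nat \<Rightarrow> rat mfps" where
  "elem_sym r = mfps_Sum (\<lambda>S. \<Prod>i\<in>S. mfps_var i) {S. S \<subseteq> {1..} \<and> finite S \<and> card S = r}"

lemma finite_colorings_monomial:
  assumes "finite (fst G)"
  shows "finite {k \<in> proper_colorings G.
           mfps_coeff (\<Prod>v\<in>fst G. mfps_var (k v) :: rat mfps) m \<noteq> 0}"
proof (rule finite_subset)
  show "finite (fst G \<rightarrow>\<^sub>E set_mset m)"
    using assms by (simp add: finite_PiE)
qed (use assms in \<open>auto simp: proper_colorings_def mfps_coeff_prod_var PiE_iff extensional_def split: if_splits\<close>)

lemma finite_elem_monomial:
  "finite {S. (S \<subseteq> {1..} \<and> finite S \<and> card S = r) \<and>
     mfps_coeff (\<Prod>i\<in>S. mfps_var i :: rat mfps) m \<noteq> 0}"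
  by (rule finite_subset[of _ "Pow (set_mset m)"])
     (auto simp: mfps_coeff_prod_var split: if_splits)

definition cycle_graph :: "nat \<Rightarrow> nat graph" where
  "cycle_graph n = ({..<n}, {{i, (i + 1) mod n} | i. i < n})"

text \<open>Adds a new vertex \<open>v'\<close>, adjacent to \<open>v\<close> and to all neighbors of \<open>v\<close>.\<close>

definition twin :: "'v \<Rightarrow> 'v \<Rightarrow> 'v graph \<Rightarrow> 'v graph" where
  "twin v v' G =
     (insert v' (fst G), snd G \<union> {{v', v}} \<union> {{v', u} | u. {v, u} \<in> snd G})"


section \<open>Compositions\<close>

definition compositions :: "nat \<Rightarrow> nat list set" where
  "compositions n = {I. (\<forall>i\<in>set I. 1 \<le> i) \<and> sum_list I = n}"

definition compositions_ge2 :: "nat \<Rightarrow> nat list set" where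
  "compositions_ge2 n = {I \<in> compositions n. \<forall>i\<in>set I. 2 \<le> i}"

lemma finite_compositions: "finite (compositions n)"
proof (rule finite_subset)
  show "compositions n \<subseteq> {I. set I \<subseteq> {..n} \<and> length I \<le> n}"
  proof
    fix I assume I: "I \<in> compositions n"
    have "length I \<le> sum_list I" if "\<forall>i\<in>set I. 1 \<le> i"
      using that by (induction I) auto
    with I show "I \<in> {I. set I \<subseteq> {..n} \<and> length I \<le> n}"
      by (auto simp: compositions_def intro: member_le_sum_list)
  qed
qed (simp add: finite_lists_length_le)

definition elem_comp :: "nat list \<Rightarrow> rat mfps" where
  "elem_comp I = prod_list (map elem_sym I)"

definition comp_weight :: "nat list \<Rightarrow> rat" where
  "comp_weight I = of_nat (hd I) * prod_list (map (\<lambda>i. of_nat i - 1) (tl I))"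

end

(*
  Restricting to finitely many colours turns both sides into elements of an ordinary commutative
  ring. Put y_a = x_a z, t_a = y_a / (1 + y_a), T = sum t_a, Q = sum t_a^2 and E = prod (1 + y_a).
  Fix the colours a, b of the twins and let s = t_a + t_b. A first-step recursion for the path
  formed by the remaining vertices, whose end points avoid a and b, gives the generating function
  Omega_ab = (T - s) (1 - s) / (1 - T).
  Since y_a t_a = y_a - t_a, the sum of y_a y_b Omega_ab over all pairs a, b collapses to a
  combination of 1, T and T^2 - Q over 1 - T. Multiplied by E these become E, z E' = E T and
  z^2 E'' = E (T^2 - Q), which are linear in the e_k, while the denominator becomes
  E - z E' = 1 - sum (k - 1) e_k z^k, whose inverse generates the weights of the compositions.
*)
theory Submission
  imports Defs "HOL-Computational_Algebra.Formal_Power_Series"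
begin

section \<open>Sums over compositions\<close>

lemma compositions_0 [simp]: "compositions 0 = {[]}"
proof -
  have "I = []" if "I \<in> compositions 0" for I
    using that by (cases I) (auto simp: compositions_def)
  then show ?thesis by (auto simp: compositions_def)
qed

lemma sum_compositions_Cons:
  assumes "k \<ge> 1"
  shows "(\<Sum>I\<in>compositions k. h I) = (\<Sum>i=1..k. \<Sum>I\<in>compositions (k - i). h (i # I))"
proof -
  have "(\<Sum>i=1..k. \<Sum>I\<in>compositions (k - i). h (i # I))
      = (\<Sum>(i, I)\<in>Sigma {1..k} (\<lambda>i. compositions (k - i)). h (i # I))"
    by (rule sum.Sigma) (auto simp: finite_compositions)
  also have "\<dots> = (\<Sum>I\<in>compositions k. h I)"
  proof (rule sum.reindex_bij_witness[of _ "\<lambda>I. (hd I, tl I)" "\<lambda>(i, I). i # I"])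
    fix I assume "I \<in> compositions k"
    with assms obtain i J where "I = i # J" by (cases I) (auto simp: compositions_def)
    with \<open>I \<in> compositions k\<close>
    show "(hd I, tl I) \<in> Sigma {1..k} (\<lambda>i. compositions (k - i))"
      and "(case (hd I, tl I) of (i, I) \<Rightarrow> i # I) = I"
      by (auto simp: compositions_def)
  qed (auto simp: compositions_def)
  finally show ?thesis ..
qed

definition comp_fps :: "(nat \<Rightarrow> 'r::comm_ring_1) \<Rightarrow> 'r fps" where
  "comp_fps c = Abs_fps (\<lambda>k. \<Sum>I\<in>compositions k. prod_list (map c I))"

text \<open>Splitting off the first part is a Cauchy product. The first part has its own weight
  \<open>g\<close> because w_I treats i_1 differently from the other parts; \<open>g 0 = 0\<close>
  reflects that parts are positive.\<close>

lemma comp_fps_nth_hd: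
  assumes "k \<ge> 1" "g 0 = 0"
  shows "(\<Sum>I\<in>compositions k. g (hd I) * prod_list (map c (tl I))) = fps_nth (Abs_fps g * comp_fps c) k"
proof -
  have "fps_nth (Abs_fps g * comp_fps c) k
      = (\<Sum>i=0..k. g i * (\<Sum>I\<in>compositions (k - i). prod_list (map c I)))"
    by (simp add: fps_mult_nth comp_fps_def)
  also have "\<dots> = (\<Sum>i=1..k. g i * (\<Sum>I\<in>compositions (k - i). prod_list (map c I)))"
    by (rule sum.mono_neutral_right) (use assms in \<open>auto simp: not_less_eq_eq\<close>)
  finally show ?thesis
    using assms(1) by (simp add: sum_compositions_Cons sum_distrib_left)
qed

text \<open>Splitting off the first part gives P = 1 + c P, where the 1 is the empty composition, so
  P is the geometric series 1 / (1 - c).\<close>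

lemma comp_fps_inverse:
  assumes "c 0 = 0"
  shows "comp_fps c * (1 - Abs_fps c) = 1"
proof -
  have "comp_fps c = 1 + Abs_fps c * comp_fps c"
  proof (rule fps_ext)
    fix k
    show "fps_nth (comp_fps c) k = fps_nth (1 + Abs_fps c * comp_fps c) k"
    proof (cases "k = 0")
      case True
      then show ?thesis using assms by (simp add: comp_fps_def)
    next
      case False
      have "fps_nth (comp_fps c) k = (\<Sum>I\<in>compositions k. c (hd I) * prod_list (map c (tl I)))"
        unfolding comp_fps_def fps_nth_Abs_fps
      proof (rule sum.cong)
        fix I assume "I \<in> compositions k"
        with False obtain i J where "I = i # J" by (cases I) (auto simp: compositions_def)
        then show "prod_list (map c I) = c (hd I) * prod_list (map c (tl I))" by simp
      qed simp
      also have "\<dots> = fps_nth (Abs_fps c * comp_fps c) k"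
        using False assms by (intro comp_fps_nth_hd) auto
      finally show ?thesis using False by simp
    qed
  qed
  then show ?thesis by (simp add: algebra_simps)
qed

section \<open>Elementary symmetric polynomials\<close>

definition esum :: "(nat \<Rightarrow> 'r::comm_ring_1) \<Rightarrow> nat set \<Rightarrow> nat \<Rightarrow> 'r" where
  "esum x C k = (\<Sum>S | S \<subseteq> C \<and> card S = k. \<Prod>i\<in>S. x i)"

lemma esum_0:
  assumes "finite C"
  shows "esum x C 0 = 1"
proof -
  have "{S. S \<subseteq> C \<and> card S = 0} = {{}}" using assms by (auto dest: finite_subset)
  then show ?thesis by (simp add: esum_def)
qed

lemma esum_empty_Suc: "esum x {} (Suc k) = 0"
proof -
  have "{S :: nat set. S \<subseteq> {} \<and> card S = Suc k} = {}" by auto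
  then show ?thesis by (simp only: esum_def sum.empty)
qed

lemma esum_insert_Suc:
  assumes "finite C" "a \<notin> C"
  shows "esum x (insert a C) (Suc k) = esum x C (Suc k) + x a * esum x C k"
proof -
  let ?A = "{S. S \<subseteq> C \<and> card S = Suc k}" and ?B = "{S. S \<subseteq> C \<and> card S = k}"
  have fin: "finite S" if "S \<subseteq> C" for S using that assms finite_subset by blast
  have "{S. S \<subseteq> insert a C \<and> card S = Suc k} = ?A \<union> insert a ` ?B"
  proof (intro set_eqI iffI)
    fix S assume S: "S \<in> {S. S \<subseteq> insert a C \<and> card S = Suc k}"
    show "S \<in> ?A \<union> insert a ` ?B"
    proof (cases "a \<in> S")
      case True
      then have "S = insert a (S - {a})" "S - {a} \<in> ?B" using S by auto
      then show ?thesis by blast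
    qed (use S in auto)
  qed (use assms fin in \<open>auto simp: card_insert_if\<close>)
  moreover have "?A \<inter> insert a ` ?B = {}" using assms by auto
  moreover have "inj_on (insert a) ?B" using assms by (auto simp: inj_on_def)
  moreover have "(\<Sum>S\<in>?B. \<Prod>i\<in>insert a S. x i) = (\<Sum>S\<in>?B. x a * (\<Prod>i\<in>S. x i))"
    using assms fin by (intro sum.cong) (auto intro!: prod.insert)
  ultimately show ?thesis
    using assms by (simp add: esum_def sum.union_disjoint sum.reindex sum_distrib_left)
qed

lemma esum_1:
  assumes "finite C"
  shows "esum x C (Suc 0) = (\<Sum>a\<in>C. x a)"
  using assms by induction (auto simp: esum_empty_Suc esum_insert_Suc esum_0)

text \<open>Newton's identity for the second power sum, kept with the factor 2 because 2 need not be
  invertible in the ring.\<close>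

lemma esum_2:
  assumes "finite C"
  shows "2 * esum x C (Suc (Suc 0)) = (\<Sum>a\<in>C. x a)\<^sup>2 - (\<Sum>a\<in>C. (x a)\<^sup>2)"
  using assms
  by induction
     (auto simp: esum_empty_Suc esum_insert_Suc esum_1 power2_eq_square algebra_simps)

section \<open>Generating functions in finitely many colours\<close>

locale colours =
  fixes x :: "nat \<Rightarrow> 'r::comm_ring_1" and C :: "nat set"
  assumes finite_C: "finite C"
begin

text \<open>The factor z = \<open>fps_X\<close> counts coloured vertices, so that one coefficient
  selects the size of the graph.\<close>

definition y :: "nat \<Rightarrow> 'r fps" where "y a = fps_const (x a) * fps_X"

text \<open>The alternating geometric series of y_a / (1 + y_a), written out since the coefficients
  form only a commutative ring.\<close>

definition t :: "nat \<Rightarrow> 'r fps" where "t a = Abs_fps (\<lambda>k. if k = 0 then 0 else - ((- x a) ^ k))"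

definition T :: "'r fps" where "T = (\<Sum>a\<in>C. t a)"

definition Q :: "'r fps" where "Q = (\<Sum>a\<in>C. t a * t a)"

definition E :: "'r fps" where "E = Abs_fps (esum x C)"

text \<open>Everything later about \<open>t a\<close> rests on this equation, an equivalent of (1 +
  y_a) t_a = y_a.\<close>

lemma t_y: "t a * y a = y a - t a"
proof -
  have "t a * fps_X * fps_const (x a) = y a - t a"
    unfolding y_def
    apply (rule fps_ext)
    subgoal for k by (cases k; cases "k - 1") (auto simp: t_def)
    done
  then show ?thesis by (simp add: y_def mult_ac)
qed

lemma E_prod: "E = (\<Prod>a\<in>C. 1 + y a)"
proof -
  have "Abs_fps (esum x D) = (\<Prod>a\<in>D. 1 + y a)" if "finite D" for D
    using that
  proof induction
    case empty
    show ?case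
      apply (rule fps_ext)
      subgoal for k by (cases k) (auto simp: esum_empty_Suc esum_0)
      done
  next
    case (insert a D)
    have "Abs_fps (esum x (insert a D)) = (1 + y a) * Abs_fps (esum x D)"
      apply (rule fps_ext)
      subgoal for k
        using insert.hyps
        by (cases k) (auto simp: esum_insert_Suc esum_0 y_def distrib_right mult.assoc)
      done
    with insert show ?case by simp
  qed
  with finite_C show ?thesis by (simp add: E_def)
qed

text \<open>Logarithmic differentiation of the product: z E' / E is the sum of the t_a, and z^2 E''
  / E is the sum of t_a t_b over ordered pairs of distinct colours. Induction on the colour set
  avoids any division.\<close>

lemma E_deriv:
  "fps_X * fps_deriv E = E * T"
  "fps_X * (fps_X * fps_deriv (fps_deriv E)) = E * (T * T - Q)"
proof -
  have "fps_X * fps_deriv (\<Prod>a\<in>D. 1 + y a) = (\<Prod>a\<in>D. 1 + y a) * (\<Sum>a\<in>D. t a) \<and>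
        fps_X * (fps_X * fps_deriv (fps_deriv (\<Prod>a\<in>D. 1 + y a)))
          = (\<Prod>a\<in>D. 1 + y a) * ((\<Sum>a\<in>D. t a) * (\<Sum>a\<in>D. t a) - (\<Sum>a\<in>D. t a * t a))"
    if "finite D" for D
    using that
  proof induction
    case empty
    show ?case by simp
  next
    case (insert a D)
    define G where "G = (\<Prod>a\<in>D. 1 + y a)"
    define U where "U = (\<Sum>a\<in>D. t a)"
    define V where "V = (\<Sum>a\<in>D. t a * t a)"
    have IH: "fps_X * fps_deriv G = G * U" "fps_X * (fps_X * fps_deriv (fps_deriv G)) = G * (U * U - V)"
      using insert.IH by (auto simp: G_def U_def V_def)
    have dy: "fps_deriv (y a) = fps_const (x a)" "fps_X * fps_const (x a) = y a"
      by (auto simp: y_def mult.commute)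
    have ty: "(1 + y a) * t a = y a" using t_y[of a] by (simp add: algebra_simps)
    have "fps_X * fps_deriv ((1 + y a) * G) = y a * G + (1 + y a) * (fps_X * fps_deriv G)"
      by (simp add: dy(1) algebra_simps flip: dy(2))
    also have "\<dots> = (1 + y a) * t a * G + (1 + y a) * (G * U)"
      by (simp only: IH ty)
    also have "\<dots> = (1 + y a) * G * (t a + U)"
      by (simp add: algebra_simps)
    finally have 1: "fps_X * fps_deriv ((1 + y a) * G) = (1 + y a) * G * (t a + U)" .
    \<comment> \<open>As y_a is linear in z, the Leibniz rule leaves only the mixed term and the
      term in G''.\<close>
    have "fps_X * (fps_X * fps_deriv (fps_deriv ((1 + y a) * G)))
        = 2 * y a * (fps_X * fps_deriv G) + (1 + y a) * (fps_X * (fps_X * fps_deriv (fps_deriv G)))"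
      by (simp add: dy(1) algebra_simps flip: dy(2))
    also have "\<dots> = 2 * ((1 + y a) * t a) * (G * U) + (1 + y a) * (G * (U * U - V))"
      by (simp only: IH ty)
    also have "\<dots> = (1 + y a) * G * ((t a + U) * (t a + U) - (t a * t a + V))"
      by (simp add: algebra_simps)
    finally show ?case
      using insert.hyps 1 by (simp add: G_def U_def V_def)
  qed
  with finite_C show "fps_X * fps_deriv E = E * T"
    "fps_X * (fps_X * fps_deriv (fps_deriv E)) = E * (T * T - Q)"
    by (auto simp: E_prod T_def Q_def)
qed

end

lemma sum_lists_Suc:
  assumes "finite C"
  shows "(\<Sum>l | set l \<subseteq> C \<and> length l = Suc m. h l)
       = (\<Sum>c\<in>C. \<Sum>l | set l \<subseteq> C \<and> length l = m. h (c # l))"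
proof -
  have "(\<Sum>c\<in>C. \<Sum>l | set l \<subseteq> C \<and> length l = m. h (c # l))
      = (\<Sum>(c, l)\<in>C \<times> {l. set l \<subseteq> C \<and> length l = m}. h (c # l))"
    by (rule sum.cartesian_product)
  also have "\<dots> = (\<Sum>l | set l \<subseteq> C \<and> length l = Suc m. h l)"
  proof (rule sum.reindex_bij_witness[of _ "\<lambda>l. (hd l, tl l)" "\<lambda>(c, l). c # l"])
    fix l assume l: "l \<in> {l. set l \<subseteq> C \<and> length l = Suc m}"
    then obtain c l' where "l = c # l'" by (cases l) auto
    with l show "(hd l, tl l) \<in> C \<times> {l. set l \<subseteq> C \<and> length l = m}"
      and "(case (hd l, tl l) of (c, l) \<Rightarrow> c # l) = l" by auto
  qed auto
  finally show ?thesis ..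
qed

lemma fps_const_sum: "fps_const (\<Sum>a\<in>A. f a) = (\<Sum>a\<in>A. fps_const (f a))"
  by (rule fps_ext) (simp add: fps_sum_nth)

section \<open>Proper colourings of a path by first-step recursion\<close>

context colours
begin

text \<open>Weighs the proper colourings of a path with m + 1 vertices whose first colour is c. Only
  the last vertex is kept away from S, since this condition passes unchanged to the rest of the
  path; the first vertex is restricted in \<open>Omega\<close>.\<close>

definition walk :: "nat set \<Rightarrow> nat \<Rightarrow> nat \<Rightarrow> 'r" where
  "walk S m c = (\<Sum>l | set l \<subseteq> C \<and> length l = m.
     if distinct_adj (c # l) \<and> last (c # l) \<notin> S then prod_list (map x (c # l)) else 0)"

lemma walk_0: "walk S 0 c = (if c \<in> S then 0 else x c)"
proof -
  have "{l. set l \<subseteq> C \<and> length l = 0} = {[]}" by auto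
  then show ?thesis by (simp add: walk_def)
qed

text \<open>Sum over all second colours and subtract the case where c is repeated, which can occur
  only if c lies in C.\<close>

lemma walk_Suc: "walk S (Suc m) c = x c * ((\<Sum>d\<in>C. walk S m d) - (if c \<in> C then walk S m c else 0))"
proof -
  have "walk S (Suc m) c = (\<Sum>d\<in>C. if c = d then 0 else x c * walk S m d)"
    unfolding walk_def sum_lists_Suc[OF finite_C] sum_distrib_left
    by (rule sum.cong) (auto intro!: sum.cong simp: mult.assoc)
  also have "\<dots> = (\<Sum>d\<in>C. x c * walk S m d - (if c = d then x c * walk S m d else 0))"
    by (rule sum.cong) auto
  finally show ?thesis
    using finite_C by (simp add: sum_subtractf sum_distrib_left right_diff_distrib)
qed

text \<open>The two ends of the path are adjacent to both twins, while inner vertices may reuse a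
  and b. The shift makes the exponent equal to the number m + 1 of path vertices.\<close>

definition Omega :: "nat \<Rightarrow> nat \<Rightarrow> 'r fps" where
  "Omega a b = fps_X * Abs_fps (\<lambda>m. \<Sum>c\<in>C - {a, b}. walk {a, b} m c)"

text \<open>The recursion is linear and can be solved in terms of the total \<open>\<Psi>\<close>
  over all first colours. With s = t_a + t_b, summing over all of C gives (1 - T)
  \<open>\<Psi>\<close> = T - s, and summing over the colours other than a, b gives
  \<open>Omega a b\<close> = (T - s) (1 + \<open>\<Psi>\<close>).\<close>

lemma Omega_eq:
  assumes "a \<in> C" "b \<in> C" "a \<noteq> b"
  shows "(1 - T) * Omega a b = (T - (t a + t b)) * (1 - (t a + t b))"
proof -
  define \<Phi> where "\<Phi> c = fps_X * Abs_fps (\<lambda>m. walk {a, b} m c)" for c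
  define \<Psi> where "\<Psi> = (\<Sum>c\<in>C. \<Phi> c)"
  \<comment> \<open>Accounts for the one-vertex path, whose first vertex is also its last.\<close>
  define \<delta> :: "nat \<Rightarrow> 'r fps" where "\<delta> c = (if c \<in> {a, b} then 0 else 1)" for c
  have sum_nth: "fps_nth \<Psi> m = (if m = 0 then 0 else \<Sum>c\<in>C. walk {a, b} (m - 1) c)" for m
    by (simp add: \<Psi>_def \<Phi>_def fps_sum_nth)
  have step: "\<Phi> c + y c * \<Phi> c = y c * (\<delta> c + \<Psi>)" if "c \<in> C" for c
  proof -
    have "\<Phi> c = fps_const (x c) * (fps_X * (\<delta> c + \<Psi> - \<Phi> c))"
    proof (rule fps_ext)
      fix k
      show "fps_nth (\<Phi> c) k = fps_nth (fps_const (x c) * (fps_X * (\<delta> c + \<Psi> - \<Phi> c))) k"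
      proof (cases k)
        case (Suc m)
        then show ?thesis
          using that by (cases m) (auto simp: \<Phi>_def \<delta>_def sum_nth walk_0 walk_Suc)
      qed (simp add: \<Phi>_def)
    qed
    then have "\<Phi> c = y c * (\<delta> c + \<Psi> - \<Phi> c)" by (simp only: y_def mult.assoc)
    then show ?thesis by (simp add: algebra_simps)
  qed
  \<comment> \<open>Solves the recursion without dividing by 1 + y_c: multiplying it by t_c turns
    the left side into y_c \<open>\<Phi> c\<close>, which is then substituted back.\<close>
  have \<Phi>: "\<Phi> c = t c * (\<delta> c + \<Psi>)" if "c \<in> C" for c
  proof -
    have ty: "t c + t c * y c = y c" by (simp add: t_y)
    have "t c * (\<Phi> c + y c * \<Phi> c) = (t c + t c * y c) * \<Phi> c" by (simp add: algebra_simps)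
    then have "y c * \<Phi> c = t c * (y c * (\<delta> c + \<Psi>))" by (simp only: step[OF that] ty)
    also have "\<dots> = y c * (\<delta> c + \<Psi>) - t c * (\<delta> c + \<Psi>)"
      using t_y[of c] by (simp add: left_diff_distrib flip: mult.assoc)
    finally have y\<Phi>: "y c * \<Phi> c = y c * (\<delta> c + \<Psi>) - t c * (\<delta> c + \<Psi>)" .
    have "\<Phi> c = y c * (\<delta> c + \<Psi>) - y c * \<Phi> c" using step[OF that] by (simp add: eq_diff_eq)
    then show ?thesis unfolding y\<Phi> by simp
  qed
  have T_split: "(\<Sum>c\<in>C - {a, b}. t c) = T - (t a + t b)"
    using assms finite_C by (simp add: T_def sum_diff)
  have "(\<Sum>c\<in>C. \<Phi> c) = (\<Sum>c\<in>C. t c * (\<delta> c + \<Psi>))"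
    by (rule sum.cong) (simp_all add: \<Phi>)
  then have "\<Psi> = (\<Sum>c\<in>C. t c * \<delta> c) + T * \<Psi>"
    by (simp add: T_def distrib_left sum.distrib sum_distrib_right flip: \<Psi>_def)
  also have "(\<Sum>c\<in>C. t c * \<delta> c) = (\<Sum>c\<in>C - {a, b}. t c)"
    by (rule sum.mono_neutral_cong_right) (use finite_C in \<open>auto simp: \<delta>_def\<close>)
  finally have \<Psi>: "\<Psi> - T * \<Psi> = T - (t a + t b)" by (simp add: T_split algebra_simps)
  have "Omega a b = (\<Sum>c\<in>C - {a, b}. \<Phi> c)"
    by (rule fps_ext) (simp add: Omega_def \<Phi>_def fps_sum_nth)
  also have "\<dots> = (T - (t a + t b)) * (1 + \<Psi>)"
    unfolding T_split[symmetric] sum_distrib_right by (rule sum.cong) (auto simp: \<Phi> \<delta>_def)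
  also have "(1 - T) * \<dots> = (T - (t a + t b)) * (1 - T + (\<Psi> - T * \<Psi>))"
    by (simp add: algebra_simps)
  finally show ?thesis unfolding \<Psi> by (simp add: algebra_simps)
qed

section \<open>Summation over the colours of the twins\<close>

lemma y_sums:
  "(\<Sum>a\<in>C. y a) = fps_const (esum x C 1) * fps_X"
  "(\<Sum>a\<in>C. y a * y a) = (\<Sum>a\<in>C. y a) * (\<Sum>a\<in>C. y a) - 2 * (fps_const (esum x C 2) * fps_X\<^sup>2)"
proof -
  show p: "(\<Sum>a\<in>C. y a) = fps_const (esum x C 1) * fps_X"
    using finite_C by (simp add: esum_1 y_def fps_const_sum flip: sum_distrib_right)
  have "(\<Sum>a\<in>C. y a * y a) = (\<Sum>a\<in>C. fps_const ((x a)\<^sup>2) * fps_X\<^sup>2)"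
    by (rule sum.cong) (simp_all add: y_def power2_eq_square mult_ac flip: fps_const_mult)
  also have "\<dots> = fps_const ((esum x C 1)\<^sup>2 - 2 * esum x C 2) * fps_X\<^sup>2"
    using finite_C esum_2[OF finite_C, of x]
    by (simp add: esum_1 fps_const_sum numeral_2_eq_2 flip: sum_distrib_right)
  also have "\<dots> = (\<Sum>a\<in>C. y a) * (\<Sum>a\<in>C. y a) - 2 * (fps_const (esum x C 2) * fps_X\<^sup>2)"
    unfolding p
    by (simp add: power2_eq_square algebra_simps numeral_fps_const flip: fps_const_sub fps_const_mult)
  finally show "(\<Sum>a\<in>C. y a * y a) = \<dots>" .
qed

text \<open>With s = t_a + t_b the summand is y_a y_b (T - (1 + T) s + s^2). Reducing y t and y t^2
  to lower terms makes each term a product of functions of a single colour, so the full double sum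
  factors into p, T and Q; the diagonal is then subtracted.\<close>

lemma pair_sum:
  defines "p \<equiv> fps_const (esum x C 1) * fps_X" and "\<epsilon> \<equiv> fps_const (esum x C 2) * fps_X\<^sup>2"
  shows "(\<Sum>a\<in>C. \<Sum>b\<in>C - {a}. y a * y b * ((T - (t a + t b)) * (1 - (t a + t b))))
    = 4 * \<epsilon> + 6 * p - (2 * \<epsilon> + 6 * p + 6) * T + (2 * p + 4) * (T * T - Q)"
proof -
  define q where "q = (\<Sum>a\<in>C. y a * y a)"
  have p: "(\<Sum>a\<in>C. y a) = p" and q: "q = p * p - 2 * \<epsilon>"
    using y_sums by (auto simp: p_def \<epsilon>_def q_def)
  have yt1: "y a * t a = y a - t a" for a
    by (simp add: t_y mult.commute)
  have yt2: "y a * (t a * t a) = y a - t a - t a * t a" for a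
    by (simp add: yt1 left_diff_distrib flip: mult.assoc)
  note yt = yt1 yt2
  define f where "f a b = T * (y a * y b) - (1 + T) * ((y a - t a) * y b + y a * (y b - t b))
      + (y a - t a - t a * t a) * y b + y a * (y b - t b - t b * t b)
      + 2 * ((y a - t a) * (y b - t b))" for a b
  have f: "y a * y b * ((T - (t a + t b)) * (1 - (t a + t b))) = f a b" for a b
    unfolding f_def yt2[symmetric] unfolding yt1[symmetric] by (simp add: algebra_simps)
  \<comment> \<open>On the diagonal s = 2 t_a, whence the factors 2 and 4.\<close>
  have diag: "f a a = T * (y a * y a) - (1 + T) * (2 * (y a * y a - (y a - t a)))
      + 4 * (y a * y a - 2 * y a + 2 * t a + t a * t a)" for a
  proof -
    have 1: "y a * (y a * t a) = y a * y a - (y a - t a)"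
      by (simp add: yt right_diff_distrib)
    have 2: "y a * (y a * (t a * t a)) = y a * y a - 2 * y a + 2 * t a + t a * t a"
      by (simp add: yt right_diff_distrib)
    have "f a a = T * (y a * y a) - (1 + T) * (2 * (y a * (y a * t a))) + 4 * (y a * (y a * (t a * t a)))"
      unfolding f[symmetric] by (simp add: algebra_simps)
    then show ?thesis unfolding 1 2 .
  qed
  have "(\<Sum>a\<in>C. \<Sum>b\<in>C - {a}. f a b) = (\<Sum>a\<in>C. \<Sum>b\<in>C. f a b) - (\<Sum>a\<in>C. f a a)"
    using finite_C by (simp add: sum_diff1 flip: sum_subtractf)
  moreover have "(\<Sum>a\<in>C. \<Sum>b\<in>C. f a b) = T * (p * p) - (1 + T) * ((p - T) * p + p * (p - T))
      + (p - T - Q) * p + p * (p - T - Q) + 2 * ((p - T) * (p - T))"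
    unfolding f_def T_def[symmetric] Q_def[symmetric] p[symmetric]
    by (simp add: sum.distrib sum_subtractf p T_def[symmetric] Q_def[symmetric]
        flip: sum_distrib_left sum_distrib_right)
  moreover have "(\<Sum>a\<in>C. f a a) = T * q - (1 + T) * (2 * (q - (p - T))) + 4 * (q - 2 * p + 2 * T + Q)"
    unfolding diag
    by (simp add: sum.distrib sum_subtractf p T_def[symmetric] Q_def[symmetric] q_def[symmetric]
        flip: sum_distrib_left sum_distrib_right)
  \<comment> \<open>The p^2 of the double sum and the q of the diagonal remain only in the
    combination p^2 - q = 2 \<open>\<epsilon>\<close>.\<close>
  ultimately show ?thesis
    unfolding f q by (simp add: algebra_simps)
qed

section \<open>Return to elementary symmetric functions and compositions\<close>

definition e :: "nat \<Rightarrow> 'r" where "e = esum x C"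

text \<open>The weight of every part after the first. Without the exception at 0 the formula would
  give -e_0 to a part that no composition has.\<close>

definition w :: "nat \<Rightarrow> 'r" where "w k = (if k = 0 then 0 else (of_nat k - 1) * e k)"

text \<open>\<open>gA\<close>, \<open>gB\<close>, \<open>gD\<close> collect the dependence of the three sums on the first part \<open>i\<^sub>1\<close>, including
  the factor \<open>i\<^sub>1\<close> of \<open>w\<^sub>I\<close>, which clears the denominator in the third sum.\<close>

definition gA :: "nat \<Rightarrow> 'r" where
  "gA k = (if 4 \<le> k then (of_nat k - 3) * (of_nat k - 1) * e k else 0)"

definition gB :: "nat \<Rightarrow> 'r" where
  "gB k = (if 3 \<le> k then 2 * (2 * of_nat k - 5) * of_nat k * e k else 0)"

definition gD :: "nat \<Rightarrow> 'r" where
  "gD k = (if 3 \<le> k then (of_nat k * of_nat k - 3 * of_nat k + 1) * e k else 0)"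

lemma E_nth:
  "fps_nth E k = e k"
  "fps_nth (E * T) k = of_nat k * e k"
  "fps_nth (E * (T * T - Q)) k = of_nat k * (of_nat k - 1) * e k"
proof -
  show E: "fps_nth E k = e k" for k by (simp add: E_def e_def)
  have "fps_nth (fps_X * fps_deriv E) k = of_nat k * e k"
    by (cases k) (simp_all add: E)
  then show "fps_nth (E * T) k = of_nat k * e k" by (simp only: E_deriv)
  have "fps_nth (fps_X * (fps_X * fps_deriv (fps_deriv E))) k = of_nat k * (of_nat k - 1) * e k"
    by (cases k; cases "k - 1") (simp_all add: E algebra_simps)
  then show "fps_nth (E * (T * T - Q)) k = of_nat k * (of_nat k - 1) * e k" by (simp only: E_deriv)
qed

lemma e_0: "e 0 = 1"
  using finite_C by (simp add: e_def esum_0)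

lemma w_fps: "1 - Abs_fps w = E * (1 - T)"
proof (rule fps_ext)
  fix k
  show "fps_nth (1 - Abs_fps w) k = fps_nth (E * (1 - T)) k"
    unfolding right_diff_distrib fps_sub_nth mult_1_right E_nth
    by (simp add: w_def e_0 algebra_simps)
qed

text \<open>Each polynomial in k is expanded in the basis k (k - 1), k, 1, whose series are z^2 E'',
  z E' and E. The remaining terms cancel its values below the cut-off, namely at k = 0, 1,
  2.\<close>

lemma heads_fps:
  defines "p \<equiv> fps_const (e 1) * fps_X" and "\<epsilon> \<equiv> fps_const (e 2) * fps_X\<^sup>2"
  shows "Abs_fps gA = E * (T * T - Q) - 3 * (E * T) + 3 * E - 3 + \<epsilon>"
    and "Abs_fps gB = 4 * (E * (T * T - Q)) - 6 * (E * T) + 6 * p + 4 * \<epsilon>"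
    and "Abs_fps gD = E * (T * T - Q) - 2 * (E * T) + E - 1 + p + \<epsilon>"
proof -
  have p: "fps_nth p k = (if k = 1 then e 1 else 0)" for k
    by (simp add: p_def)
  have \<epsilon>: "fps_nth \<epsilon> k = (if k = 2 then e 2 else 0)" for k
    by (simp add: \<epsilon>_def fps_X_power_nth)
  have cs: "k = 0 \<or> k = 1 \<or> k = 2 \<or> k = 3 \<or> 4 \<le> k" for k :: nat by arith
  have num: "fps_nth (numeral m * f) k = numeral m * fps_nth f k" for m k and f :: "'r fps"
    by (simp add: numeral_fps_const)
  show "Abs_fps gA = E * (T * T - Q) - 3 * (E * T) + 3 * E - 3 + \<epsilon>"
  proof (rule fps_ext)
    fix k
    show "fps_nth (Abs_fps gA) k = fps_nth (E * (T * T - Q) - 3 * (E * T) + 3 * E - 3 + \<epsilon>) k"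
      unfolding fps_add_nth fps_sub_nth num E_nth \<epsilon>
      using cs[of k] by (auto simp: gA_def e_0 fps_numeral_nth algebra_simps)
  qed
  show "Abs_fps gB = 4 * (E * (T * T - Q)) - 6 * (E * T) + 6 * p + 4 * \<epsilon>"
  proof (rule fps_ext)
    fix k
    show "fps_nth (Abs_fps gB) k = fps_nth (4 * (E * (T * T - Q)) - 6 * (E * T) + 6 * p + 4 * \<epsilon>) k"
      unfolding fps_add_nth fps_sub_nth num E_nth \<epsilon> p
      using cs[of k] by (auto simp: gB_def e_0 algebra_simps)
  qed
  show "Abs_fps gD = E * (T * T - Q) - 2 * (E * T) + E - 1 + p + \<epsilon>"
  proof (rule fps_ext)
    fix k
    show "fps_nth (Abs_fps gD) k = fps_nth (E * (T * T - Q) - 2 * (E * T) + E - 1 + p + \<epsilon>) k"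
      unfolding fps_add_nth fps_sub_nth num E_nth \<epsilon> p
      using cs[of k] by (auto simp: gD_def e_0 algebra_simps)
  qed
qed

text \<open>After multiplication by E (1 - T) the left side is known from \<open>pair_sum\<close>;
  \<open>comp_fps w\<close> is the inverse of that factor and brings in the compositions.\<close>

lemma twin_fps:
  defines "p \<equiv> fps_const (e 1) * fps_X" and "\<epsilon> \<equiv> fps_const (e 2) * fps_X\<^sup>2"
    and "P \<equiv> comp_fps w"
  shows "(\<Sum>a\<in>C. \<Sum>b\<in>C - {a}. y a * y b * Omega a b) =
    2 * p * (Abs_fps gA * P) + Abs_fps gB * P - \<epsilon> * (Abs_fps gB * P) + 4 * \<epsilon> * (Abs_fps gD * P)"
proof -
  define L where "L = (\<Sum>a\<in>C. \<Sum>b\<in>C - {a}. y a * y b * Omega a b)"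
  define E1 where "E1 = E * T"
  define E2 where "E2 = E * (T * T - Q)"
  have "(1 - T) * L = (\<Sum>a\<in>C. \<Sum>b\<in>C - {a}. y a * y b * ((1 - T) * Omega a b))"
    by (simp add: L_def sum_distrib_left mult_ac)
  also have "\<dots> = (\<Sum>a\<in>C. \<Sum>b\<in>C - {a}. y a * y b * ((T - (t a + t b)) * (1 - (t a + t b))))"
    by (intro sum.cong refl) (simp add: Omega_eq)
  also have "\<dots> = 4 * \<epsilon> + 6 * p - (2 * \<epsilon> + 6 * p + 6) * T + (2 * p + 4) * (T * T - Q)"
    by (simp add: pair_sum p_def \<epsilon>_def e_def)
  finally have "E * (1 - T) * L = E * (4 * \<epsilon> + 6 * p - (2 * \<epsilon> + 6 * p + 6) * T + (2 * p + 4) * (T * T - Q))"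
    by (simp add: mult.assoc)
  also have "\<dots> = (4 * \<epsilon> + 6 * p) * E - (2 * \<epsilon> + 6 * p + 6) * E1 + (2 * p + 4) * E2"
    by (simp add: E1_def E2_def algebra_simps)
  \<comment> \<open>With these multipliers the coefficients of E, z E' and z^2 E'' match, and the
    low-degree corrections of the three heads cancel. The multiplier 1 - \<open>\<epsilon>\<close>
    later deletes the compositions ending in 2.\<close>
  also have "\<dots> = 2 * p * Abs_fps gA + (1 - \<epsilon>) * Abs_fps gB + 4 * \<epsilon> * Abs_fps gD"
    unfolding heads_fps E1_def[symmetric] E2_def[symmetric] p_def[symmetric] \<epsilon>_def[symmetric]
    by (simp add: algebra_simps)
  finally have *: "E * (1 - T) * L = 2 * p * Abs_fps gA + (1 - \<epsilon>) * Abs_fps gB + 4 * \<epsilon> * Abs_fps gD" .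
  have "P * (E * (1 - T)) = 1"
    using comp_fps_inverse[of w] by (simp add: w_fps P_def w_def)
  then have "L = P * (E * (1 - T) * L)" by (simp flip: mult.assoc)
  then show ?thesis unfolding * L_def[symmetric] by (simp add: algebra_simps)
qed

text \<open>This is the coefficient of z^(n+1), one factor z for each vertex of the twinned cycle;
  multiplication by e_1 z and by e_2 z^2 shifts the size of the composition to n and n - 1.\<close>

lemma twin_colour_sum:
  assumes "n \<ge> 3"
  shows "(\<Sum>a\<in>C. \<Sum>b\<in>C - {a}. x a * x b * (\<Sum>c\<in>C - {a, b}. walk {a, b} (n - 2) c)) =
      2 * e 1 * (\<Sum>I\<in>compositions n. gA (hd I) * prod_list (map w (tl I)))
    + (\<Sum>I\<in>compositions (n + 1). gB (hd I) * prod_list (map w (tl I)))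
    - e 2 * (\<Sum>I\<in>compositions (n - 1). gB (hd I) * prod_list (map w (tl I)))
    + 4 * e 2 * (\<Sum>I\<in>compositions (n - 1). gD (hd I) * prod_list (map w (tl I)))"
proof -
  from assms obtain k where n: "n = Suc (Suc k)" "k \<ge> 1" by (metis Suc_le_D Suc_le_mono One_nat_def numeral_3_eq_3)
  \<comment> \<open>The twins contribute z^2 and \<open>Omega\<close> a shift by one, so exponent n
    + 1 meets index n - 2 of \<open>walk\<close>, a path with n - 1 vertices.\<close>
  have "fps_nth (\<Sum>a\<in>C. \<Sum>b\<in>C - {a}. y a * y b * Omega a b) (Suc n)
      = (\<Sum>a\<in>C. \<Sum>b\<in>C - {a}. x a * x b * (\<Sum>c\<in>C - {a, b}. walk {a, b} (n - 2) c))"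
  proof -
    have "y a * y b * Omega a b = fps_const (x a) * (fps_const (x b) * (fps_X * (fps_X * Omega a b)))" for a b
      by (simp only: y_def mult_ac)
    then show ?thesis by (simp add: fps_sum_nth Omega_def n mult.assoc)
  qed
  moreover have zero: "gA 0 = 0" "gB 0 = 0" "gD 0 = 0"
    by (simp_all add: gA_def gB_def gD_def)
  moreover have nth1: "fps_nth (2 * (fps_const (e 1) * fps_X) * f) (Suc n) = 2 * e 1 * fps_nth f n" for f
    by (simp add: numeral_fps_const mult.assoc)
  moreover have nth2: "fps_nth (fps_const (e 2) * fps_X\<^sup>2 * f) (Suc n) = e 2 * fps_nth f (n - 1)" for f
    by (simp add: power2_eq_square mult.assoc n)
  moreover have nth4: "fps_nth (4 * (fps_const (e 2) * fps_X\<^sup>2) * f) (Suc n) = 4 * e 2 * fps_nth f (n - 1)" for f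
    by (simp add: numeral_fps_const power2_eq_square mult.assoc n)
  ultimately show ?thesis
    using assms zero
    by (simp only: twin_fps fps_add_nth fps_sub_nth nth1 nth2 nth4) (simp add: comp_fps_nth_hd)
qed

end

section \<open>Colourings as lists\<close>

text \<open>Serves to replace sums over colourings by sums over colour lists, on which the
  first-step recursion acts.\<close>

lemma bij_betw_map_PiE:
  assumes "distinct vs"
  shows "bij_betw (\<lambda>k. map k vs) (set vs \<rightarrow>\<^sub>E C) {l. set l \<subseteq> C \<and> length l = length vs}"
proof (rule bij_betw_imageI)
  show "inj_on (\<lambda>k. map k vs) (set vs \<rightarrow>\<^sub>E C)"
    by (auto simp: inj_on_def intro: PiE_ext)
  show "(\<lambda>k. map k vs) ` (set vs \<rightarrow>\<^sub>E C) = {l. set l \<subseteq> C \<and> length l = length vs}"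
  proof (intro set_eqI iffI)
    fix l assume l: "l \<in> {l. set l \<subseteq> C \<and> length l = length vs}"
    define k where "k = (\<lambda>v\<in>set vs. the (map_of (zip vs l) v))"
    have nth: "k (vs ! i) = l ! i" if "i < length vs" for i
      using that l assms by (simp add: k_def map_of_zip_nth)
    have "k v \<in> C" if v: "v \<in> set vs" for v
    proof -
      from v obtain i where "i < length vs" "v = vs ! i" by (auto simp: in_set_conv_nth)
      then show ?thesis using nth l by (auto simp: subset_iff)
    qed
    then have "k \<in> set vs \<rightarrow>\<^sub>E C" by (auto simp: k_def)
    moreover have "map k vs = l" using l nth by (auto intro: nth_equalityI)
    ultimately show "l \<in> (\<lambda>k. map k vs) ` (set vs \<rightarrow>\<^sub>E C)" by blast
  qed auto
qed

text \<open>The entries are the colours of v', of v, and then of the path left when v is removed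
  from the cycle. That path has n - 1 vertices, so \<open>hd\<close> and \<open>last\<close> never
  meet an empty list in the application.\<close>

definition good :: "nat list \<Rightarrow> bool" where
  "good l = (case l of a # b # L \<Rightarrow>
     a \<noteq> b \<and> hd L \<notin> {a, b} \<and> distinct_adj L \<and> last L \<notin> {a, b} | _ \<Rightarrow> False)"

text \<open>Isolates the edge condition of \<open>proper_colorings\<close>, so that it can be split
  along the edge sets joined in \<open>twin\<close>.\<close>

definition separates :: "('a \<Rightarrow> 'b) \<Rightarrow> 'a set set \<Rightarrow> bool" where
  "separates k F \<longleftrightarrow> (\<forall>u w. {u, w} \<in> F \<longrightarrow> k u \<noteq> k w)"

lemma separates_Un: "separates k (F \<union> G) \<longleftrightarrow> separates k F \<and> separates k G"
  by (auto simp: separates_def)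

lemma separates_family:
  "separates k {{f i, g i} | i. P i} \<longleftrightarrow> (\<forall>i. P i \<longrightarrow> k (f i) \<noteq> k (g i))"
proof
  assume *: "\<forall>i. P i \<longrightarrow> k (f i) \<noteq> k (g i)"
  show "separates k {{f i, g i} | i. P i}"
    unfolding separates_def
  proof (intro allI impI)
    fix u w assume "{u, w} \<in> {{f i, g i} | i. P i}"
    then obtain i where "{u, w} = {f i, g i}" "P i" by blast
    with * show "k u \<noteq> k w" by (metis doubleton_eq_iff)
  qed
qed (auto simp: separates_def)

lemma separates_singleton: "separates k {{a, b}} \<longleftrightarrow> k a \<noteq> k b"
  using separates_family[of k "\<lambda>_::unit. a" "\<lambda>_. b" "\<lambda>_. True"] by simp

section \<open>The twinned cycle as a pair of twins and a path\<close>

locale twin_cycle =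
  fixes n v v' :: nat
  assumes n: "n \<ge> 3" and v: "v < n" and v': "v' \<ge> n"
begin

text \<open>Renumbers the cycle from v: its neighbours become \<open>r 1\<close> and
  \<open>r (n - 1)\<close>, the ends of the remaining path.\<close>

definition r :: "nat \<Rightarrow> nat" where "r i = (v + i) mod n"

lemma r_0: "r 0 = v" and r_n: "r n = v" and r_Suc: "r (Suc i) = (r i + 1) mod n"
  using v by (simp_all add: r_def mod_Suc_eq)

lemma image_r: "r ` {..<n} = {..<n}"
proof
  show "{..<n} \<subseteq> r ` {..<n}"
  proof
    fix m assume m: "m \<in> {..<n}"
    \<comment> \<open>The inverse rotation; adding n first keeps the natural subtraction from
      truncating.\<close>
    then have "r ((m + n - v) mod n) = m"
      using v by (simp add: r_def mod_add_right_eq)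
    moreover have "(m + n - v) mod n \<in> {..<n}" using v by simp
    ultimately show "m \<in> r ` {..<n}" by (metis image_eqI)
  qed
qed (use v in \<open>auto simp: r_def\<close>)

lemma inj_r: "inj_on r {..<n}"
  by (rule eq_card_imp_inj_on) (simp_all add: image_r)

lemma cycle_edges: "snd (cycle_graph n) = {{r i, r (Suc i)} | i. i < n}"
proof -
  have "snd (cycle_graph n) = (\<lambda>j. {j, (j + 1) mod n}) ` r ` {..<n}"
    by (auto simp: cycle_graph_def image_r)
  also have "\<dots> = {{r i, r (Suc i)} | i. i < n}"
    unfolding image_image by (auto simp: r_Suc)
  finally show ?thesis .
qed

lemma neighbours: "{v, u} \<in> snd (cycle_graph n) \<longleftrightarrow> u = r 1 \<or> u = r (n - 1)"
proof
  assume "{v, u} \<in> snd (cycle_graph n)"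
  then obtain i where i: "i < n" "{r 0, u} = {r i, r (Suc i)}"
    by (auto simp: cycle_edges r_0)
  then consider "r 0 = r i" "u = r (Suc i)" | "r 0 = r (Suc i)" "u = r i"
    by (auto simp: doubleton_eq_iff)
  then show "u = r 1 \<or> u = r (n - 1)"
  proof cases
    case 1
    then have "i = 0" using inj_r i n by (auto simp: inj_on_def)
    with 1 show ?thesis by simp
  next
    case 2
    \<comment> \<open>By injectivity below n, the vertex \<open>r 0\<close> recurs only when the
      index wraps around at n.\<close>
    have "\<not> Suc i < n" using inj_onD[OF inj_r 2(1)] n by auto
    then have "i = n - 1" using i by simp
    with 2 show ?thesis by simp
  qed
next
  assume "u = r 1 \<or> u = r (n - 1)"
  then have "{v, u} = {r 0, r (Suc 0)} \<or> {v, u} = {r (n - 1), r (Suc (n - 1))}"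
    using n r_0 r_n by (auto simp: insert_commute)
  then show "{v, u} \<in> snd (cycle_graph n)"
    using n unfolding cycle_edges by (elim disjE) (auto intro: exI[of _ "0 :: nat"] exI[of _ "n - 1"])
qed

definition vs :: "nat list" where "vs = v' # map r [0..<n]"

lemma vs_eq: "vs = v' # v # map r [1..<n]"
  using n by (simp add: vs_def upt_conv_Cons r_0)

lemma distinct_vs: "distinct vs" and set_vs: "set vs = fst (twin v v' (cycle_graph n))"
  using inj_r image_r v' by (auto simp: vs_def distinct_map twin_def cycle_graph_def atLeast0LessThan)

text \<open>The first and last steps around the cycle are its two edges at v; the other steps are
  the edges of the path.\<close>

lemma separates_iff_good:
  "separates k (snd (twin v v' (cycle_graph n))) \<longleftrightarrow> good (map k vs)"
proof -
  have "separates k (snd (twin v v' (cycle_graph n))) \<longleftrightarrow>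
      (\<forall>i<n. k (r i) \<noteq> k (r (Suc i))) \<and> k v' \<noteq> k v \<and> k v' \<noteq> k (r 1) \<and> k v' \<noteq> k (r (n - 1))"
    unfolding twin_def snd_conv separates_Un separates_singleton separates_family neighbours
    unfolding cycle_edges separates_family by blast
  also have "(\<forall>i<n. k (r i) \<noteq> k (r (Suc i))) \<longleftrightarrow>
      k v \<noteq> k (r 1) \<and> (\<forall>i. Suc (Suc i) < n \<longrightarrow> k (r (Suc i)) \<noteq> k (r (Suc (Suc i)))) \<and> k (r (n - 1)) \<noteq> k v"
    (is "?A \<longleftrightarrow> ?B")
  proof
    assume A: ?A
    then have "k (r i) \<noteq> k (r (Suc i))" if "i < n" for i using that by blast
    from this[of 0] this[of "n - 1"] A show ?B using n by (simp add: r_0 r_n)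
  next
    assume B: ?B
    show ?A
    proof (intro allI impI)
      fix i assume i: "i < n"
      consider "i = 0" | j where "i = Suc j" "Suc i < n" | "i = n - 1" using i by (cases i; force)
      then show "k (r i) \<noteq> k (r (Suc i))"
        using B n by cases (simp_all add: r_0 r_n)
    qed
  qed
  also have "(\<forall>i. Suc (Suc i) < n \<longrightarrow> k (r (Suc i)) \<noteq> k (r (Suc (Suc i)))) \<longleftrightarrow>
      distinct_adj (map k (map r [1..<n]))"
    by (auto simp: distinct_adj_conv_nth less_diff_conv)
  finally show ?thesis
    using n by (auto simp: good_def vs_eq hd_map last_map)
qed


lemma length_vs: "length vs = Suc (Suc (Suc (n - 2)))"
  using n by (simp add: vs_def)

lemma sum_colourings:
  assumes "colours C"
  shows "(\<Sum>k | k \<in> fst (twin v v' (cycle_graph n)) \<rightarrow>\<^sub>E C \<and> separates k (snd (twin v v' (cycle_graph n))).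
            \<Prod>u\<in>fst (twin v v' (cycle_graph n)). x (k u))
       = (\<Sum>a\<in>C. \<Sum>b\<in>C - {a}. x a * x b * (\<Sum>c\<in>C - {a, b}. colours.walk x C {a, b} (n - 2) c))"
proof -
  interpret colours x C by fact
  let ?V = "fst (twin v v' (cycle_graph n))"
  let ?h = "\<lambda>l. if good l then prod_list (map x l) else 0"
  have finV: "finite ?V" by (simp flip: set_vs)
  have "(\<Sum>k | k \<in> ?V \<rightarrow>\<^sub>E C \<and> separates k (snd (twin v v' (cycle_graph n))). \<Prod>u\<in>?V. x (k u))
      = (\<Sum>k\<in>?V \<rightarrow>\<^sub>E C. ?h (map k vs))"
  proof (rule sum.mono_neutral_cong_left)
    show "finite (?V \<rightarrow>\<^sub>E C)" using finV finite_C by (rule finite_PiE)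
    fix k assume "k \<in> {k. k \<in> ?V \<rightarrow>\<^sub>E C \<and> separates k (snd (twin v v' (cycle_graph n)))}"
    then show "(\<Prod>u\<in>?V. x (k u)) = ?h (map k vs)"
      using distinct_vs
      by (simp add: separates_iff_good prod.distinct_set_conv_list comp_def flip: set_vs)
  qed (auto simp: separates_iff_good)
  also have "\<dots> = (\<Sum>l | set l \<subseteq> C \<and> length l = length vs. ?h l)"
    by (rule sum.reindex_bij_betw) (use bij_betw_map_PiE[OF distinct_vs] in \<open>simp add: set_vs\<close>)
  \<comment> \<open>Peels off the colours of v', v and \<open>r 1\<close>; the other n - 2 vertices
    are the list summed over in \<open>walk\<close>.\<close>
  also have "\<dots> = (\<Sum>a\<in>C. \<Sum>b\<in>C. \<Sum>c\<in>C. \<Sum>l | set l \<subseteq> C \<and> length l = n - 2. ?h (a # b # c # l))"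
    unfolding length_vs by (simp only: sum_lists_Suc[OF finite_C])
  also have "\<dots> = (\<Sum>a\<in>C. \<Sum>b\<in>C - {a}. x a * x b * (\<Sum>c\<in>C - {a, b}. walk {a, b} (n - 2) c))"
  proof (rule sum.cong[OF refl], rule sum.mono_neutral_cong_right)
    fix a b assume b: "b \<in> C - {a}"
    have "(\<Sum>c\<in>C. \<Sum>l | set l \<subseteq> C \<and> length l = n - 2. ?h (a # b # c # l))
        = (\<Sum>c\<in>C - {a, b}. x a * x b * walk {a, b} (n - 2) c)"
    proof (rule sum.mono_neutral_cong_right)
      fix c assume "c \<in> C - {a, b}"
      with b show "(\<Sum>l | set l \<subseteq> C \<and> length l = n - 2. ?h (a # b # c # l))
          = x a * x b * walk {a, b} (n - 2) c"
        unfolding walk_def sum_distrib_left by (intro sum.cong) (auto simp: good_def mult.assoc)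
    qed (use finite_C in \<open>auto simp: good_def intro!: sum.neutral\<close>)
    then show "(\<Sum>c\<in>C. \<Sum>l | set l \<subseteq> C \<and> length l = n - 2. ?h (a # b # c # l))
        = x a * x b * (\<Sum>c\<in>C - {a, b}. walk {a, b} (n - 2) c)"
      by (simp add: sum_distrib_left)
  qed (use finite_C in \<open>auto simp: good_def intro!: sum.neutral\<close>)
  finally show ?thesis .
qed

end

section \<open>Truncation to finitely many colours\<close>

text \<open>Index 0 is included because the final identity concerns all monomials, although 0 is
  never a colour.\<close>

definition agree :: "nat \<Rightarrow> 'a mfps \<Rightarrow> 'a mfps \<Rightarrow> bool" where
  "agree N f g \<longleftrightarrow> (\<forall>m. set_mset m \<subseteq> {..N} \<longrightarrow> mfps_coeff f m = mfps_coeff g m)"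

lemma agree_refl: "agree N f f"
  by (simp add: agree_def)

lemma agree_add: "agree N f f' \<Longrightarrow> agree N g g' \<Longrightarrow> agree N (f + g) (f' + g')"
  for f g :: "'a::comm_ring_1 mfps"
  by (simp add: agree_def plus_mfps.rep_eq)

text \<open>The coefficient of a monomial in a product depends only on its divisors, which involve
  no further variables.\<close>

lemma agree_mult: "agree N f f' \<Longrightarrow> agree N g g' \<Longrightarrow> agree N (f * g) (f' * g')"
  for f g :: "'a::comm_ring_1 mfps"
  unfolding agree_def times_mfps.rep_eq by (intro allI impI sum.cong) auto

lemma agree_scale: "agree N f f' \<Longrightarrow> agree N (mfps_scale c f) (mfps_scale c f')"
  by (simp add: agree_def mfps_scale.rep_eq)

lemma agree_sum: "(\<And>i. i \<in> A \<Longrightarrow> agree N (f i) (g i)) \<Longrightarrow> agree N (sum f A) (sum g A)"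
  for f g :: "_ \<Rightarrow> 'a::comm_ring_1 mfps"
  by (induction A rule: infinite_finite_induct) (auto simp: agree_refl agree_add)

lemma agree_prod_list:
  "(\<And>i. agree N (f i) (g i)) \<Longrightarrow> agree N (prod_list (map f I)) (prod_list (map g I))"
  for f g :: "_ \<Rightarrow> 'a::comm_ring_1 mfps"
  by (induction I) (auto simp: agree_refl agree_mult)

lemma mfps_coeff_sum: "mfps_coeff (sum f A) m = (\<Sum>i\<in>A. mfps_coeff (f i) m)"
  for f :: "_ \<Rightarrow> 'a::comm_ring_1 mfps"
  by (induction A rule: infinite_finite_induct) (auto simp: zero_mfps.rep_eq plus_mfps.rep_eq)

text \<open>Members outside B contribute to no monomial in the variables up to N, so the formal sum
  may be replaced by a finite ring sum.\<close>

lemma agree_mfps_Sum: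
  fixes f :: "_ \<Rightarrow> 'a::comm_ring_1 mfps"
  assumes "finite B" "B \<subseteq> A"
    and "\<And>k m. k \<in> A \<Longrightarrow> set_mset m \<subseteq> {..N} \<Longrightarrow> mfps_coeff (f k) m \<noteq> 0 \<Longrightarrow> k \<in> B"
  shows "agree N (mfps_Sum f A) (\<Sum>k\<in>B. f k)"
  unfolding agree_def mfps_Sum.rep_eq mfps_coeff_sum
  using assms by (intro allI impI sum.mono_neutral_left) auto

lemma agree_elem_sym: "agree N (elem_sym k) (esum mfps_var {0<..N} k)"
  unfolding elem_sym_def esum_def
proof (rule agree_mfps_Sum)
  show "finite {S. S \<subseteq> {0<..N} \<and> card S = k}"
    by (rule finite_subset[of _ "Pow {0<..N}"]) auto
  show "{S. S \<subseteq> {0<..N} \<and> card S = k} \<subseteq> {S. S \<subseteq> {1..} \<and> finite S \<and> card S = k}"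
    using finite_subset[of _ "{0<..N}"] by auto
next
  fix S m
  assume "S \<in> {S. S \<subseteq> {1..} \<and> finite S \<and> card S = k}" "set_mset m \<subseteq> {..N}"
    "mfps_coeff (\<Prod>i\<in>S. mfps_var i :: rat mfps) m \<noteq> 0"
  then have "S \<subseteq> {1..} \<inter> {..N}" "card S = k"
    by (auto simp: mfps_coeff_prod_var split: if_splits)
  then show "S \<in> {S. S \<subseteq> {0<..N} \<and> card S = k}"
    by (auto simp: subset_iff Suc_le_eq)
qed

lemma agree_chromatic:
  assumes "finite (fst G)"
  shows "agree N (chromatic_sym G)
    (\<Sum>k | k \<in> fst G \<rightarrow>\<^sub>E {0<..N} \<and> separates k (snd G). \<Prod>v\<in>fst G. mfps_var (k v))"
  unfolding chromatic_sym_def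
proof (rule agree_mfps_Sum)
  show "finite {k. k \<in> fst G \<rightarrow>\<^sub>E {0<..N} \<and> separates k (snd G)}"
    by (rule finite_subset[of _ "fst G \<rightarrow>\<^sub>E {0<..N}"]) (use assms in \<open>auto intro: finite_PiE\<close>)
  show "{k. k \<in> fst G \<rightarrow>\<^sub>E {0<..N} \<and> separates k (snd G)} \<subseteq> proper_colorings G"
    by (auto simp: proper_colorings_def separates_def PiE_iff)
next
  fix k m
  assume "k \<in> proper_colorings G" "set_mset m \<subseteq> {..N}"
    "mfps_coeff (\<Prod>v\<in>fst G. mfps_var (k v) :: rat mfps) m \<noteq> 0"
  then show "k \<in> {k. k \<in> fst G \<rightarrow>\<^sub>E {0<..N} \<and> separates k (snd G)}"
    using assms
    by (auto simp: proper_colorings_def separates_def PiE_iff mfps_coeff_prod_var split: if_splits)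
qed

section \<open>Rational coefficients\<close>

text \<open>Turns scalars into series, so that scaling becomes multiplication and coefficients can
  be compared by ring identities.\<close>

definition mfps_const :: "'a::comm_ring_1 \<Rightarrow> 'a mfps" where
  "mfps_const c = mfps_scale c 1"

lemma mfps_scale_conv_const: "mfps_scale c f = mfps_const c * f"
proof -
  have "mfps_scale c g * f = mfps_scale c (g * f)" for g
    by (rule mfps_eqI)
       (simp add: mfps_scale.rep_eq times_mfps.rep_eq sum_distrib_left case_prod_unfold mult.assoc)
  from this[of 1] show ?thesis by (simp add: mfps_const_def)
qed

lemma mfps_const_hom:
  "mfps_const 0 = 0" "mfps_const 1 = 1"
  "mfps_const (a + b) = mfps_const a + mfps_const b"
  "mfps_const (a - b) = mfps_const a - mfps_const b"
  "mfps_const (a * b) = mfps_const a * mfps_const b"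
proof -
  show "mfps_const (a * b) = mfps_const a * mfps_const b"
    unfolding mfps_scale_conv_const[symmetric] unfolding mfps_const_def
    by (rule mfps_eqI) (simp add: mfps_scale.rep_eq mult.assoc)
qed (unfold mfps_const_def, (rule mfps_eqI, simp add: mfps_scale.rep_eq zero_mfps.rep_eq
      one_mfps.rep_eq plus_mfps.rep_eq minus_mfps.rep_eq algebra_simps)+)

lemma mfps_const_of_nat: "mfps_const (of_nat k) = of_nat k"
  by (induction k) (simp_all add: mfps_const_hom)

lemma mfps_const_numeral: "mfps_const (numeral k) = numeral k"
  using mfps_const_of_nat[of "numeral k"] by simp

lemmas mfps_const_simps = mfps_const_hom mfps_const_of_nat mfps_const_numeral

lemma (in colours) prod_list_w:
  fixes c :: "nat \<Rightarrow> 'r"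
  assumes "\<forall>i\<in>set J. 1 \<le> i"
  shows "prod_list (map w J) = prod_list (map (\<lambda>i. of_nat i - 1) J) * prod_list (map e J)"
  using assms by (induction J) (auto simp: w_def mult_ac)

lemma mfps_const_prod_list:
  "mfps_const (prod_list (map (\<lambda>i. of_nat i - 1) J)) = prod_list (map (\<lambda>i. of_nat i - 1) J)"
  by (induction J) (simp_all add: mfps_const_simps)

section \<open>The twinned cycle\<close>

lemma compositions_Cons:
  assumes "I \<in> compositions k" "k > 0"
  shows "\<exists>i J. I = i # J \<and> i \<ge> 1 \<and> (\<forall>j\<in>set J. 1 \<le> j)"
  using assms by (cases I) (auto simp: compositions_def)

section \<open>Eliminating parts 1 and final parts 2\<close>

context colours
begin

lemma prod_list_w_eq_0: "1 \<in> set J \<Longrightarrow> prod_list (map w J) = 0"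
  by (induction J) (auto simp: w_def)

text \<open>As w_2 = e_2, deleting a final 2 matches the compositions of n + 1 that end in 2 with
  the subtracted sum. A part 1 after the first has weight 0, and \<open>gB\<close> discards first
  parts below 3.\<close>

lemma sum_gB:
  assumes "n \<ge> 3"
  shows "(\<Sum>I\<in>compositions (n + 1). gB (hd I) * prod_list (map w (tl I)))
    - e 2 * (\<Sum>I\<in>compositions (n - 1). gB (hd I) * prod_list (map w (tl I)))
    = (\<Sum>I | I \<in> compositions_ge2 (n + 1) \<and> hd I \<ge> 3 \<and> last I \<ge> 3. gB (hd I) * prod_list (map w (tl I)))"
proof -
  let ?h = "\<lambda>I. gB (hd I) * prod_list (map w (tl I))"
  let ?A = "{I \<in> compositions (n + 1). last I = 2}"
  have "sum ?h (compositions (n + 1)) = sum ?h ?A + sum ?h (compositions (n + 1) - ?A)"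
    using finite_compositions[of "n + 1"] sum.subset_diff[of ?A "compositions (n + 1)" ?h]
    by (simp add: add.commute)
  also have "sum ?h ?A = (\<Sum>I\<in>compositions (n - 1). e 2 * ?h I)"
  proof (rule sum.reindex_bij_witness[of _ "\<lambda>I. I @ [2]" butlast])
    fix I assume I: "I \<in> ?A"
    then obtain i J where IJ: "I = i # J" using compositions_Cons[of I "n + 1"] by auto
    \<comment> \<open>A single part equal to 2 would force n + 1 = 2.\<close>
    with I assms have "J \<noteq> []" by (auto simp: compositions_def)
    moreover from this have "last J = 2" using I IJ by simp
    ultimately obtain J' where J: "J = J' @ [2]" by (metis append_butlast_last_id)
    show "butlast I @ [2] = I" "butlast I \<in> compositions (n - 1)"
      using I assms by (auto simp: IJ J compositions_def)
    show "e 2 * ?h (butlast I) = ?h I"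
      by (simp add: IJ J w_def mult_ac)
  qed (use assms in \<open>auto simp: compositions_def\<close>)
  also have "sum ?h (compositions (n + 1) - ?A) =
      (\<Sum>I | I \<in> compositions_ge2 (n + 1) \<and> hd I \<ge> 3 \<and> last I \<ge> 3. ?h I)"
  proof (rule sum.mono_neutral_right)
    show "{I. I \<in> compositions_ge2 (n + 1) \<and> hd I \<ge> 3 \<and> last I \<ge> 3} \<subseteq> compositions (n + 1) - ?A"
      by (auto simp: compositions_ge2_def)
    show "\<forall>I\<in>compositions (n + 1) - ?A - {I. I \<in> compositions_ge2 (n + 1) \<and> hd I \<ge> 3 \<and> last I \<ge> 3}. ?h I = 0"
    proof
      fix I assume I: "I \<in> compositions (n + 1) - ?A - {I. I \<in> compositions_ge2 (n + 1) \<and> hd I \<ge> 3 \<and> last I \<ge> 3}"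
      then obtain i J where IJ: "I = i # J" "i \<ge> 1" "\<forall>j\<in>set J. 1 \<le> j"
        using compositions_Cons[of I "n + 1"] by auto
      show "?h I = 0"
      \<comment> \<open>If i is at least 3 and no part is 1, a last part other than 2 is at least 3,
        so I would belong to the smaller index set.\<close>
      proof (cases "i \<ge> 3 \<and> 1 \<notin> set J")
        case True
        then have ge2: "\<forall>j\<in>set J. 2 \<le> j" using IJ(3) le_neq_implies_less by (metis Suc_1 Suc_leI One_nat_def)
        then have "last I \<ge> 2" using True by (auto simp: IJ)
        moreover have "last I \<noteq> 2" using I by auto
        ultimately have False using I True ge2 by (auto simp: IJ compositions_ge2_def)
        then show ?thesis ..
      qed (auto simp: IJ gB_def prod_list_w_eq_0)
    qed
  qed (simp add: finite_compositions)
  finally show ?thesis by (simp add: sum_distrib_left)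
qed

lemma sum_gD:
  assumes "n \<ge> 3"
  shows "(\<Sum>I\<in>compositions (n - 1). gD (hd I) * prod_list (map w (tl I)))
    = (\<Sum>I | I \<in> compositions_ge2 (n - 1) \<and> hd I \<ge> 3. gD (hd I) * prod_list (map w (tl I)))"
proof (rule sum.mono_neutral_right)
  show "\<forall>I\<in>compositions (n - 1) - {I. I \<in> compositions_ge2 (n - 1) \<and> hd I \<ge> 3}.
      gD (hd I) * prod_list (map w (tl I)) = 0"
  proof
    fix I assume I: "I \<in> compositions (n - 1) - {I. I \<in> compositions_ge2 (n - 1) \<and> hd I \<ge> 3}"
    then obtain i J where IJ: "I = i # J" "i \<ge> 1" "\<forall>j\<in>set J. 1 \<le> j"
      using assms compositions_Cons[of I "n - 1"] by auto
    show "gD (hd I) * prod_list (map w (tl I)) = 0"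
    proof (cases "i \<ge> 3 \<and> 1 \<notin> set J")
      case True
      then have "\<forall>j\<in>set J. 2 \<le> j" using IJ(3) le_neq_implies_less by (metis Suc_1 Suc_leI One_nat_def)
      then have False using I True by (auto simp: IJ compositions_ge2_def)
      then show ?thesis ..
    qed (auto simp: IJ gD_def prod_list_w_eq_0)
  qed
qed (auto simp: compositions_ge2_def finite_compositions)

lemma sum_gA:
  "(\<Sum>I\<in>compositions n. gA (hd I) * prod_list (map w (tl I)))
    = (\<Sum>I | I \<in> compositions n \<and> hd I \<ge> 4. gA (hd I) * prod_list (map w (tl I)))"
  by (rule sum.mono_neutral_right) (auto simp: gA_def finite_compositions)

end

theorem theorem4p2:
  fixes n v v' :: nat
  assumes "n \<ge> 3"
    and "v \<in> fst (cycle_graph n)"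
    and "v' \<notin> fst (cycle_graph n)"
  shows "chromatic_sym (twin v v' (cycle_graph n)) =
      (\<Sum>I | I \<in> compositions n \<and> hd I \<ge> 4.
         mfps_scale (2 * (of_nat (hd I) - 3) * comp_weight (1 # I)) (elem_comp (1 # I)))
    + (\<Sum>I | I \<in> compositions_ge2 (n + 1) \<and> hd I \<ge> 3 \<and> last I \<ge> 3.
         mfps_scale (2 * (2 * of_nat (hd I) - 5) * comp_weight I) (elem_comp I))
    + (\<Sum>I | I \<in> compositions_ge2 (n - 1) \<and> hd I \<ge> 3.
         mfps_scale (4 * (of_nat (hd I) - 3 + 1 / of_nat (hd I)) * comp_weight I)
           (elem_comp (I @ [2])))"
    (is "_ = ?A + ?B + ?D")
proof (rule mfps_eqI)
  fix m :: "nat multiset"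
  \<comment> \<open>Chosen to cover all variables of m; the inserted 0 handles the empty
    monomial.\<close>
  define N where "N = Max (insert 0 (set_mset m))"
  have m: "set_mset m \<subseteq> {..N}" by (auto simp: N_def)
  interpret twin_cycle n v v'
    using assms by unfold_locales (auto simp: cycle_graph_def)
  interpret colours "mfps_var :: nat \<Rightarrow> rat mfps" "{0<..N}"
    by unfold_locales simp
  let ?ec = "\<lambda>I. prod_list (map e I)"
  have ec: "agree N (elem_comp I) (?ec I)" for I
    unfolding elem_comp_def e_def by (intro agree_prod_list agree_elem_sym)
  have "agree N ?A (\<Sum>I | I \<in> compositions n \<and> hd I \<ge> 4.
      mfps_scale (2 * (of_nat (hd I) - 3) * comp_weight (1 # I)) (?ec (1 # I)))"
    by (intro agree_sum agree_scale ec)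
  \<comment> \<open>In \<open>comp_weight (1 # I)\<close> the head of I is no longer first and
    contributes i_1 - 1, a factor contained in \<open>gA\<close>.\<close>
  also have "\<dots> = 2 * e 1 * (\<Sum>I\<in>compositions n. gA (hd I) * prod_list (map w (tl I)))"
    unfolding sum_gA sum_distrib_left
  proof (rule sum.cong)
    fix I assume I: "I \<in> {I. I \<in> compositions n \<and> hd I \<ge> 4}"
    then obtain i J where "I = i # J" "\<forall>j\<in>set J. 1 \<le> j"
      using n compositions_Cons[of I n] by auto
    with I show "mfps_scale (2 * (of_nat (hd I) - 3) * comp_weight (1 # I)) (?ec (1 # I))
        = 2 * e 1 * (gA (hd I) * prod_list (map w (tl I)))"
      by (simp add: comp_weight_def gA_def prod_list_w mfps_scale_conv_const mfps_const_simps
          mfps_const_prod_list algebra_simps)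
  qed simp
  finally have A: "agree N ?A \<dots>" .
  have "agree N ?B (\<Sum>I | I \<in> compositions_ge2 (n + 1) \<and> hd I \<ge> 3 \<and> last I \<ge> 3.
      mfps_scale (2 * (2 * of_nat (hd I) - 5) * comp_weight I) (?ec I))"
    by (intro agree_sum agree_scale ec)
  also have "\<dots> = (\<Sum>I | I \<in> compositions_ge2 (n + 1) \<and> hd I \<ge> 3 \<and> last I \<ge> 3.
      gB (hd I) * prod_list (map w (tl I)))"
  proof (rule sum.cong)
    fix I assume I: "I \<in> {I. I \<in> compositions_ge2 (n + 1) \<and> hd I \<ge> 3 \<and> last I \<ge> 3}"
    then have "I \<in> compositions (n + 1)" by (simp add: compositions_ge2_def)
    then obtain i J where "I = i # J" "\<forall>j\<in>set J. 1 \<le> j"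
      using compositions_Cons[of I "n + 1"] by auto
    with I show "mfps_scale (2 * (2 * of_nat (hd I) - 5) * comp_weight I) (?ec I)
        = gB (hd I) * prod_list (map w (tl I))"
      by (simp add: comp_weight_def gB_def prod_list_w mfps_scale_conv_const mfps_const_simps
          mfps_const_prod_list algebra_simps)
  qed simp
  finally have B: "agree N ?B \<dots>" .
  have "agree N ?D (\<Sum>I | I \<in> compositions_ge2 (n - 1) \<and> hd I \<ge> 3.
      mfps_scale (4 * (of_nat (hd I) - 3 + 1 / of_nat (hd I)) * comp_weight I) (?ec (I @ [2])))"
    by (intro agree_sum agree_scale ec)
  \<comment> \<open>The appended 2 contributes e_2 but no weight.\<close>
  also have "\<dots> = 4 * e 2 * (\<Sum>I\<in>compositions (n - 1). gD (hd I) * prod_list (map w (tl I)))"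
    unfolding sum_gD[OF n] sum_distrib_left
  proof (rule sum.cong)
    fix I assume I: "I \<in> {I. I \<in> compositions_ge2 (n - 1) \<and> hd I \<ge> 3}"
    then have "I \<in> compositions (n - 1)" by (simp add: compositions_ge2_def)
    then obtain i J where IJ: "I = i # J" "\<forall>j\<in>set J. 1 \<le> j"
      using n compositions_Cons[of I "n - 1"] by auto
    \<comment> \<open>The factor i_1 of the weight absorbs 1 / i_1, which is legitimate because i_1
      is at least 3.\<close>
    have coeff: "4 * (of_nat (hd I) - 3 + 1 / of_nat (hd I)) * comp_weight I
        = 4 * (of_nat i * of_nat i - 3 * of_nat i + 1) * prod_list (map (\<lambda>j. of_nat j - 1) J)"
      using I by (simp add: IJ comp_weight_def field_simps)
    show "mfps_scale (4 * (of_nat (hd I) - 3 + 1 / of_nat (hd I)) * comp_weight I) (?ec (I @ [2]))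
        = 4 * e 2 * (gD (hd I) * prod_list (map w (tl I)))"
      unfolding coeff using I IJ
      by (simp add: gD_def prod_list_w mfps_scale_conv_const mfps_const_simps
          mfps_const_prod_list algebra_simps)
  qed simp
  finally have D: "agree N ?D \<dots>" .
  have fin: "finite (fst (twin v v' (cycle_graph n)))"
    by (simp flip: set_vs)
  have "agree N (chromatic_sym (twin v v' (cycle_graph n)))
    (2 * e 1 * (\<Sum>I\<in>compositions n. gA (hd I) * prod_list (map w (tl I)))
    + (\<Sum>I | I \<in> compositions_ge2 (n + 1) \<and> hd I \<ge> 3 \<and> last I \<ge> 3. gB (hd I) * prod_list (map w (tl I)))
    + 4 * e 2 * (\<Sum>I\<in>compositions (n - 1). gD (hd I) * prod_list (map w (tl I))))"
    using agree_chromatic[OF fin, of N]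
    unfolding sum_colourings[OF colours_axioms] twin_colour_sum[OF n] sum_gB[OF n, symmetric]
    by (simp add: add_diff_eq)
  moreover have "agree N (?A + ?B + ?D) \<dots>"
    by (intro agree_add A B D)
  ultimately show "mfps_coeff (chromatic_sym (twin v v' (cycle_graph n))) m = mfps_coeff (?A + ?B + ?D) m"
    using m by (simp add: agree_def)
qed

end
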